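(* Let $(X,\|\cdot\|)$ be a normed real vector space with $\dim X\geq 2$. The following are equivalent: (i) $(X,\|\cdot\|)$ is an inner product space; (ii) for all $x_{0}\in X$ and all $r>0$ we have $S(\partial B_{r}(x_{0}))=r$; (iii) there exist $x_{0}\in X$ and $r>0$ such that $S(\partial B_{r}(x_{0}))=r$.
   Context: A normed real vector space $(X,\|\cdot\|)$ is called an inner product space if there exists an inner product $\langle\cdot,\cdot\rangle$ on $X$ inducing the norm, i.e. $\|x\|=\sqrt{\langle x,x\rangle}$ for all $x\in X$ (no completeness is assumed). The dimension of $X$ may be infinite. A normed space carries the metric $d(x,y)=\|x-y\|$, and $\partial B_{r}(x_{0})=\{x\in X : \|x-x_0\|=r\}$ is the sphere of radius $r$ about $x_0$. For three mutually distinct points $u,v,w$ of a metric space $(X,d)$ put $a=d(u,v)$, $b=d(v,w)$, $c=d(w,u)$. The circumradius is $$r(u,v,w)=\frac{abc}{\sqrt{(a+b+c)(a+b-c)(a-b+c)(-a+b+c)}},$$ with $r(u,v,w)=\infty$ if the expression under the root is $0$. (This is the circumradius of the Euclidean triangle with side lengths $a,b,c$.) For a subset $M$ of a metric space, $S(M)=\sup\{r(u,v,w) : u,v,w\in M \text{ mutually distinct}\}\in(0,\infty]$. *)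

theory Defs
  imports "HOL-Analysis.Analysis"
begin

definition is_inner_product :: "('a::real_vector \<Rightarrow> 'a \<Rightarrow> real) \<Rightarrow> bool" where
  "is_inner_product ip \<longleftrightarrow>
     bilinear ip \<and> (\<forall>x y. ip x y = ip y x) \<and> (\<forall>x. x \<noteq> 0 \<longrightarrow> 0 < ip x x)"

(* The class real_inner would fix an inner product as part of the type, so the existence of
   an inner product inducing a given norm is expressed as a predicate on that norm. *)
definition induced_by_inner_product :: "('a::real_vector \<Rightarrow> real) \<Rightarrow> bool" where
  "induced_by_inner_product nrm \<longleftrightarrow>
     (\<exists>ip. is_inner_product ip \<and> (\<forall>x. nrm x = sqrt (ip x x)))"

definition circumradius :: "'a::metric_space \<Rightarrow> 'a \<Rightarrow> 'a \<Rightarrow> ereal" where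
  "circumradius u v w =
     (let a = dist u v; b = dist v w; c = dist w u;
          q = (a + b + c) * (a + b - c) * (a - b + c) * (- a + b + c)
      in if q = 0 then \<infinity> else ereal (a * b * c / sqrt q))"

(* For M with fewer than three points the supremum is over the empty set and equals -\<infinity>. *)
definition sup_circumradius :: "'a::metric_space set \<Rightarrow> ereal" where
  "sup_circumradius M =
     Sup {circumradius u v w | u v w.
            u \<in> M \<and> v \<in> M \<and> w \<in> M \<and> u \<noteq> v \<and> v \<noteq> w \<and> w \<noteq> u}"

end

theory Submission
  imports Defs
begin

text \<open>In an inner product space, three points of a sphere of radius \<open>r\<close> span a plane that cuts the
  sphere in their circumcircle, whose radius is at most \<open>r\<close>. A diameter together with a third point
  of the sphere attains \<open>r\<close> (\<open>sup_circumradius_sphere\<close>).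

  Conversely, let the circumradii on a single sphere of radius \<open>r\<close> be bounded by \<open>r\<close>. A triangle one
  of whose sides is a diameter, of length \<open>2 r\<close>, has circumradius at least \<open>r\<close>, with equality
  exactly when it is right-angled in the sense of Pythagoras. Applied to the points \<open>u, -u, v\<close> after
  normalisation, this is the rhombus law \<open>|u + v|\<^sup>2 + |u - v|\<^sup>2 = 4\<close> for all unit vectors
  (\<open>rhombus_law_if_sup_circumradius_le\<close>).

  That the rhombus law characterises inner product norms is a theorem of Day. On a plane, choose
  among the quadratic forms above the squared norm one of least trace. By minimality it touches the
  squared norm in two independent directions: otherwise tilting the form would lower the trace
  (\<open>least_majorant_has_contact_away_from\<close>). By the rhombus law the set of contacts is closed under adding vectors of equal norm
  (\<open>contact_between\<close>), and since it is a closed set it fills the plane. So the squared norm is a quadratic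
  form on every plane, and polarisation gives the inner product.\<close>

section \<open>Circumradius and Heron's formula\<close>

lemma heron_product:
  fixes a b c :: real
  shows "(a + b + c) * (a + b - c) * (a - b + c) * (- a + b + c)
       = 4 * b\<^sup>2 * c\<^sup>2 - (b\<^sup>2 + c\<^sup>2 - a\<^sup>2)\<^sup>2"
  by (simp add: power2_eq_square algebra_simps)

lemma heron_product_nonneg:
  fixes u v w :: "'a::metric_space"
  defines "a \<equiv> dist u v" and "b \<equiv> dist v w" and "c \<equiv> dist w u"
  shows "0 \<le> (a + b + c) * (a + b - c) * (a - b + c) * (- a + b + c)"
proof -
  have "c \<le> a + b" "b \<le> a + c" "a \<le> b + c"
    unfolding a_def b_def c_def
    by (metis dist_commute dist_triangle add.commute)+
  moreover have "0 \<le> a" "0 \<le> b" "0 \<le> c" by (simp_all add: a_def b_def c_def)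
  ultimately show ?thesis by (intro mult_nonneg_nonneg) auto
qed

text \<open>Squaring removes the root and also covers the degenerate case: if the product under the root
  vanishes, the circumradius is infinite and the inequality on the right fails since its
  left-hand side is positive.\<close>

lemma circumradius_le_iff:
  fixes u v w :: "'a::metric_space"
  defines "a \<equiv> dist u v" and "b \<equiv> dist v w" and "c \<equiv> dist w u"
  assumes "u \<noteq> v" "v \<noteq> w" "w \<noteq> u" and r: "0 < r"
  shows "circumradius u v w \<le> ereal r \<longleftrightarrow>
           a\<^sup>2 * b\<^sup>2 * c\<^sup>2 \<le> r\<^sup>2 * (4 * b\<^sup>2 * c\<^sup>2 - (b\<^sup>2 + c\<^sup>2 - a\<^sup>2)\<^sup>2)"
proof -
  define q where "q = (a + b + c) * (a + b - c) * (a - b + c) * (- a + b + c)"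
  have q0: "0 \<le> q" unfolding q_def a_def b_def c_def by (rule heron_product_nonneg)
  have pos: "0 < a * b * c" using assms by (simp add: a_def b_def c_def)
  have rhs: "a\<^sup>2 * b\<^sup>2 * c\<^sup>2 \<le> r\<^sup>2 * q \<longleftrightarrow> a * b * c \<le> r * sqrt q"
  proof -
    have "a\<^sup>2 * b\<^sup>2 * c\<^sup>2 \<le> r\<^sup>2 * q \<longleftrightarrow> (a * b * c)\<^sup>2 \<le> (r * sqrt q)\<^sup>2"
      using q0 by (simp add: power_mult_distrib)
    also have "\<dots> \<longleftrightarrow> a * b * c \<le> r * sqrt q"
      using pos r q0 by (simp add: abs_le_square_iff[symmetric])
    finally show ?thesis .
  qed
  have lhs: "circumradius u v w = (if q = 0 then \<infinity> else ereal (a * b * c / sqrt q))"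
    by (simp add: circumradius_def Let_def q_def a_def b_def c_def)
  have "circumradius u v w \<le> ereal r \<longleftrightarrow> a * b * c \<le> r * sqrt q"
  proof (cases "q = 0")
    case True
    then show ?thesis using pos by (simp add: lhs)
  next
    case False
    then have "0 < sqrt q" using q0 by simp
    then show ?thesis using False by (simp add: lhs pos_divide_le_eq)
  qed
  then show ?thesis using rhs heron_product[of a b c] by (simp add: q_def)
qed

text \<open>Thales: a triangle whose side \<open>a = 2 r\<close> is a diameter of its circumcircle has a right angle
  opposite to it. No triangle with a side \<open>2 r\<close> has a smaller circumradius, so an upper bound
  on the circumradius already forces the Pythagorean identity.\<close>

lemma circumradius_le_half_side_iff:
  fixes u v w :: "'a::metric_space"
  assumes dist: "u \<noteq> v" "v \<noteq> w" "w \<noteq> u" and a: "dist u v = 2 * r"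
  shows "circumradius u v w \<le> ereal r \<longleftrightarrow> (dist v w)\<^sup>2 + (dist w u)\<^sup>2 = 4 * r\<^sup>2"
proof -
  have r: "0 < r" using a dist(1) by (metis dist_pos_lt zero_less_mult_iff zero_less_numeral not_numeral_less_zero)
  define P where "P = (dist v w)\<^sup>2 + (dist w u)\<^sup>2 - 4 * r\<^sup>2"
  have "circumradius u v w \<le> ereal r \<longleftrightarrow> r\<^sup>2 * P\<^sup>2 \<le> 0"
    unfolding circumradius_le_iff[OF dist r] a P_def
    by (simp add: algebra_simps)
  also have "\<dots> \<longleftrightarrow> P = 0" using r by (simp add: mult_le_0_iff)
  finally show ?thesis by (simp add: P_def)
qed

lemma circumradius_eq_half_side:
  fixes u v w :: "'a::metric_space"
  assumes dist: "u \<noteq> v" "v \<noteq> w" "w \<noteq> u" and a: "dist u v = 2 * r"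
    and pyth: "(dist v w)\<^sup>2 + (dist w u)\<^sup>2 = 4 * r\<^sup>2"
  shows "circumradius u v w = ereal r"
proof -
  define b c where "b = dist v w" and "c = dist w u"
  have bc: "0 < b" "0 < c" using dist by (simp_all add: b_def c_def)
  have q: "(2 * r + b + c) * (2 * r + b - c) * (2 * r - b + c) * (- (2 * r) + b + c) = (2 * b * c)\<^sup>2"
    using pyth unfolding heron_product by (simp add: b_def c_def power_mult_distrib)
  show ?thesis
    unfolding circumradius_def Let_def a b_def[symmetric] c_def[symmetric] q
    using bc by (simp add: real_sqrt_mult)
qed

section \<open>The rhombus law from a bound on circumradii\<close>

lemma circumradius_le_sup:
  assumes "u \<in> M" "v \<in> M" "w \<in> M" "u \<noteq> v" "v \<noteq> w" "w \<noteq> u"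
  shows "circumradius u v w \<le> sup_circumradius M"
  unfolding sup_circumradius_def using assms by (intro Sup_upper) blast

lemma rhombus_law_if_sup_circumradius_le:
  fixes x0 u v :: "'a::real_normed_vector"
  assumes r: "0 < r" and S: "sup_circumradius (sphere x0 r) \<le> ereal r"
    and u: "norm u = 1" and v: "norm v = 1"
  shows "(norm (u + v))\<^sup>2 + (norm (u - v))\<^sup>2 = 4"
proof (cases "v = u \<or> v = - u")
  case True
  have "norm (u + u) = 2" using u by (simp flip: scaleR_2)
  then show ?thesis using True by auto
next
  case False
  let ?a = "x0 + r *\<^sub>R u" and ?b = "x0 - r *\<^sub>R u" and ?c = "x0 + r *\<^sub>R v"
  have dab: "dist ?a ?b = 2 * r"
  proof -
    have "?a - ?b = (2 * r) *\<^sub>R u" by (simp add: algebra_simps flip: scaleR_2)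
    then show ?thesis using r u by (simp add: dist_norm)
  qed
  have dbc: "dist ?b ?c = r * norm (u + v)"
  proof -
    have "?b - ?c = (- r) *\<^sub>R (u + v)" by (simp add: algebra_simps)
    then show ?thesis using r by (simp add: dist_norm del: scaleR_minus_left)
  qed
  have dca: "dist ?c ?a = r * norm (u - v)"
  proof -
    have "?c - ?a = (- r) *\<^sub>R (u - v)" by (simp add: algebra_simps)
    then show ?thesis using r by (simp add: dist_norm del: scaleR_minus_left)
  qed
  have uv: "u + v \<noteq> 0" "u - v \<noteq> 0" using False by (auto simp: eq_neg_iff_add_eq_0 add.commute)
  have ne: "?a \<noteq> ?b" "?b \<noteq> ?c" "?c \<noteq> ?a"
    using dab dbc dca r uv by (metis dist_self mult_eq_0_iff norm_eq_zero less_irrefl zero_neq_numeral)+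
  have "circumradius ?a ?b ?c \<le> sup_circumradius (sphere x0 r)"
    using r u v ne by (intro circumradius_le_sup) (auto simp: dist_norm)
  then have "circumradius ?a ?b ?c \<le> ereal r" using S by (rule order_trans)
  then have "r\<^sup>2 * ((norm (u + v))\<^sup>2 + (norm (u - v))\<^sup>2) = r\<^sup>2 * 4"
    using circumradius_le_half_side_iff[OF ne dab]
    unfolding dbc dca by (simp add: power_mult_distrib distrib_left)
  then show ?thesis using r by simp
qed

section \<open>A quadratic majorant with two directions of contact\<close>

text \<open>Every quadratic form on the plane is \<open>M * |z|\<^sup>2 + Re (cnj w * z\<^sup>2)\<close> for a unique real \<open>M\<close>
  (half its trace) and complex \<open>w\<close>.\<close>

definition quad_form :: "real \<Rightarrow> complex \<Rightarrow> complex \<Rightarrow> real" where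
  "quad_form M w z = M * (norm z)\<^sup>2 + inner w (z\<^sup>2)"

lemma quad_form_scale: "quad_form M w (c *\<^sub>R z) = c\<^sup>2 * quad_form M w z"
  by (simp add: quad_form_def power_mult_distrib inner_complex_def algebra_simps
      power2_eq_square)

lemma quad_form_parallelogram:
  "quad_form M w (y + z) + quad_form M w (y - z) = 2 * quad_form M w y + 2 * quad_form M w z"
  unfolding quad_form_def cmod_power2
  by (simp add: inner_complex_def power2_eq_square algebra_simps)

lemma quad_form_Complex:
  "quad_form M w (Complex s t) = (M + Re w) * s\<^sup>2 + 2 * Im w * s * t + (M - Re w) * t\<^sup>2"
  unfolding quad_form_def cmod_power2
  by (simp add: inner_complex_def power2_eq_square algebra_simps)

lemma continuous_on_quad_form [continuous_intros]:
  "continuous_on A (quad_form M w)"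
  unfolding quad_form_def by (intro continuous_intros)

text \<open>Since \<open>g\<close> is nonnegative, a majorant with parameters \<open>M, w\<close> must satisfy \<open>|w| \<le> M\<close>; hence the
  majorants with bounded trace form a compact set.\<close>

lemma exists_least_quad_form_majorant:
  fixes g :: "complex \<Rightarrow> real"
  assumes cont: "continuous_on (sphere 0 1) g" and nonneg: "\<And>z. norm z = 1 \<Longrightarrow> 0 \<le> g z"
  obtains M w where "\<And>z. norm z = 1 \<Longrightarrow> g z \<le> quad_form M w z"
    and "\<And>M' w'. (\<And>z. norm z = 1 \<Longrightarrow> g z \<le> quad_form M' w' z) \<Longrightarrow> M \<le> M'"
proof -
  define C where "C = {p :: real \<times> complex. \<forall>z\<in>sphere 0 1. g z \<le> quad_form (fst p) (snd p) z}"
  have "bounded (g ` sphere 0 1)"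
    by (intro compact_imp_bounded compact_continuous_image cont compact_sphere)
  then obtain M0 where M0: "\<And>z. norm z = 1 \<Longrightarrow> g z \<le> M0"
    by (metis bounded_iff imageI abs_le_D1 real_norm_def mem_sphere_0)
  have closed: "closed C"
  proof -
    have "C = (\<Inter>z\<in>sphere 0 1. {p. g z \<le> quad_form (fst p) (snd p) z})"
      by (auto simp: C_def)
    also have "closed \<dots>"
      unfolding quad_form_def
      by (intro closed_INT ballI closed_Collect_le continuous_intros)
    finally show ?thesis .
  qed
  have bound: "norm w \<le> M" if "(M, w) \<in> C" for M w
  proof (cases "w = 0")
    case True
    have "g 1 \<le> quad_form M w 1" using that by (auto simp: C_def)
    then show ?thesis using nonneg[of 1] True by (simp add: quad_form_def)
  next
    case False
    \<comment> \<open>Test the majorant in the direction in which its \<open>w\<close>-part is smallest.\<close>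
    define z where "z = csqrt (- sgn w)"
    have z2: "z\<^sup>2 = - sgn w" by (simp add: z_def)
    have "(norm z)\<^sup>2 = 1" using False by (simp add: z2 norm_sgn flip: norm_power)
    then have nz: "norm z = 1" by (simp add: power2_eq_1_iff) (metis norm_ge_zero neg_0_le_iff_le not_one_le_zero)
    have "0 \<le> quad_form M w z" using that nz order_trans[OF nonneg[OF nz]] by (simp add: C_def)
    also have "\<dots> = M - norm w"
      using False unfolding quad_form_def nz z2
      by (simp add: sgn_div_norm power2_norm_eq_inner[symmetric]) (simp add: power2_eq_square)
    finally show ?thesis by simp
  qed
  define D where "D = C \<inter> cball 0 (2 * \<bar>M0\<bar>)"
  have D: "p \<in> D" if "p \<in> C" "fst p \<le> M0" for p
  proof -
    obtain M w where p: "p = (M, w)" by (cases p)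
    have "norm p \<le> norm M + norm w" unfolding p by (rule norm_Pair_le)
    then show ?thesis using that bound[of M w] norm_ge_zero[of w] unfolding D_def p
      by (auto simp del: norm_ge_zero)
  qed
  have in_C: "(M0, 0) \<in> C" using M0 by (auto simp: C_def quad_form_def)
  have "compact D" unfolding D_def using closed by (intro closed_Int_compact compact_cball)
  moreover have "D \<noteq> {}" using D[OF in_C] by auto
  ultimately obtain p where p: "p \<in> D" "\<And>p'. p' \<in> D \<Longrightarrow> fst p \<le> fst p'"
    using continuous_attains_inf[of D fst, OF _ _ continuous_on_fst[OF continuous_on_id]] by blast
  have "fst p \<le> fst p'" if "p' \<in> C" for p'
    using p(2)[of p'] D[OF that] p(2)[OF D[OF in_C]] by fastforce
  with p(1) show thesis
    by (intro that[of "fst p" "snd p"]) (fastforce simp: C_def D_def)+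
qed

text \<open>If all contacts of the least majorant lay near the direction \<open>\<plusminus>z0\<close>, then the form could be
  raised a little in that direction while its trace is lowered, which contradicts minimality.
  Hence some contact lies far from \<open>\<plusminus>z0\<close>, whatever \<open>z0\<close> is.\<close>

lemma least_majorant_has_contact_away_from:
  fixes g :: "complex \<Rightarrow> real"
  assumes cont: "continuous_on (sphere 0 1) g"
    and maj: "\<And>z. norm z = 1 \<Longrightarrow> g z \<le> quad_form M w z"
    and least: "\<And>M' w'. (\<And>z. norm z = 1 \<Longrightarrow> g z \<le> quad_form M' w' z) \<Longrightarrow> M \<le> M'"
    and z0: "norm z0 = 1"
  obtains z where "norm z = 1" "g z = quad_form M w z" "z\<^sup>2 \<noteq> z0\<^sup>2"
proof -
  \<comment> \<open>Any bound strictly between \<open>0\<close> and \<open>1\<close> would serve: below \<open>1\<close> it keeps \<open>z0\<close> out of \<open>D\<close>, and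
    its positivity lets the trace decrease while the form does not decrease outside \<open>D\<close>.\<close>
  define D where "D = {z \<in> sphere 0 1. inner (z0\<^sup>2) (z\<^sup>2) \<le> 1/2}"
  have "D = sphere 0 1 \<inter> {z. inner (z0\<^sup>2) (z\<^sup>2) \<le> 1/2}" by (auto simp: D_def)
  then have "compact D"
    by (auto intro!: compact_Int_closed closed_Collect_le continuous_intros)
  have n0: "inner (z0\<^sup>2) (z0\<^sup>2) = 1" using z0 by (simp add: norm_power flip: power2_norm_eq_inner)
  then have "\<i> * z0 \<in> D" using z0 by (simp add: D_def norm_mult power_mult_distrib)
  then have "D \<noteq> {}" by auto
  moreover have "continuous_on D (\<lambda>z. quad_form M w z - g z)"
    by (intro continuous_intros continuous_on_subset[OF cont]) (auto simp: D_def)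
  ultimately obtain z where z: "z \<in> D"
    and min: "\<And>y. y \<in> D \<Longrightarrow> quad_form M w z - g z \<le> quad_form M w y - g y"
    using continuous_attains_inf[OF \<open>compact D\<close>] by blast
  have nz: "norm z = 1" and zz: "z\<^sup>2 \<noteq> z0\<^sup>2" using z n0 by (auto simp: D_def)
  define \<delta> where "\<delta> = quad_form M w z - g z"
  have "\<delta> = 0"
  proof (rule ccontr)
    assume "\<delta> \<noteq> 0"
    then have \<delta>: "0 < \<delta>" using maj[OF nz] by (simp add: \<delta>_def)
    have "g y \<le> quad_form (M - \<delta>/4) (w + (\<delta>/2) *\<^sub>R z0\<^sup>2) y" if y: "norm y = 1" for y
    proof -
      define k where "k = inner (z0\<^sup>2) (y\<^sup>2)"
      have eq: "quad_form (M - \<delta>/4) (w + (\<delta>/2) *\<^sub>R z0\<^sup>2) y = quad_form M w y + \<delta>/2 * (k - 1/2)"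
        by (simp add: quad_form_def y k_def inner_left_distrib algebra_simps)
      show ?thesis
      proof (cases "k \<le> 1/2")
        case True
        then have "y \<in> D" by (simp add: D_def y k_def)
        from min[OF this] have "g y \<le> quad_form M w y - \<delta>" by (simp add: \<delta>_def)
        moreover have "-1 \<le> k"
          using Cauchy_Schwarz_ineq2[of "z0\<^sup>2" "y\<^sup>2"] z0 y by (simp add: k_def norm_power)
        then have "\<delta>/2 * (- 3/2) \<le> \<delta>/2 * (k - 1/2)" using \<delta> by (intro mult_left_mono) auto
        ultimately show ?thesis unfolding eq using \<delta> by linarith
      next
        case False
        then have "0 \<le> \<delta>/2 * (k - 1/2)" using \<delta> by simp
        then show ?thesis unfolding eq using maj[OF y] by linarith
      qed
    qed
    from least[OF this] show False using \<delta> by simp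
  qed
  then show thesis using that[OF nz _ zz] by (simp add: \<delta>_def)
qed

section \<open>Spreading the contact\<close>

text \<open>Contact is invariant under scaling, so let \<open>p, q\<close> be contacts at which the norm is \<open>1\<close>. The
  majorant satisfies the parallelogram law and the norm the rhombus law, so the two inequalities at \<open>p + q\<close> and \<open>p - q\<close> add up to an
  equality and are therefore equalities themselves.\<close>

lemma contact_between:
  fixes L :: "complex \<Rightarrow> 'a::real_normed_vector"
  assumes L: "linear L"
    and rhombus: "\<forall>u v :: 'a. norm u = 1 \<longrightarrow> norm v = 1 \<longrightarrow> (norm (u + v))\<^sup>2 + (norm (u - v))\<^sup>2 = 4"
    and maj: "\<And>z. (norm (L z))\<^sup>2 \<le> quad_form M w z"
    and p: "(norm (L p))\<^sup>2 = quad_form M w p" "L p \<noteq> 0"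
    and q: "(norm (L q))\<^sup>2 = quad_form M w q" "L q \<noteq> 0"
  defines "m \<equiv> p /\<^sub>R norm (L p) + q /\<^sub>R norm (L q)"
  shows "(norm (L m))\<^sup>2 = quad_form M w m"
proof -
  define p' q' where "p' = p /\<^sub>R norm (L p)" and "q' = q /\<^sub>R norm (L q)"
  have 1: "norm (L p') = 1" "norm (L q') = 1"
    using p(2) q(2) by (simp_all add: p'_def q'_def linear_scale[OF L])
  have 2: "quad_form M w p' = 1" "quad_form M w q' = 1"
    using p q by (simp_all add: p'_def q'_def quad_form_scale power_inverse flip: p(1) q(1))
  have "(norm (L (p' + q')))\<^sup>2 + (norm (L (p' - q')))\<^sup>2 = 4"
    using rhombus 1 by (simp add: linear_add[OF L] linear_diff[OF L])
  moreover have "quad_form M w (p' + q') + quad_form M w (p' - q') = 4"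
    using quad_form_parallelogram[of M w p' q'] 2 by simp
  ultimately have "(norm (L (p' + q')))\<^sup>2 = quad_form M w (p' + q')"
    using maj[of "p' + q'"] maj[of "p' - q'"] by linarith
  then show ?thesis by (simp add: m_def p'_def q'_def)
qed

lemma contact_scale:
  fixes L :: "complex \<Rightarrow> 'a::real_normed_vector"
  assumes "linear L" and "(norm (L z))\<^sup>2 = quad_form M w z"
  shows "(norm (L (c *\<^sub>R z)))\<^sup>2 = quad_form M w (c *\<^sub>R z)"
  using assms(2) by (simp add: linear_scale[OF assms(1)] quad_form_scale power_mult_distrib)

text \<open>On the segment between two points of contact the contact set is closed and, by
  \<open>contact_between\<close>, has no gaps.\<close>

lemma contact_on_segment:
  fixes L :: "complex \<Rightarrow> 'a::real_normed_vector"
  assumes L: "linear L"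
    and rhombus: "\<forall>u v :: 'a. norm u = 1 \<longrightarrow> norm v = 1 \<longrightarrow> (norm (u + v))\<^sup>2 + (norm (u - v))\<^sup>2 = 4"
    and maj: "\<And>z. (norm (L z))\<^sup>2 \<le> quad_form M w z"
    and p0: "(norm (L z1))\<^sup>2 = quad_form M w z1"
    and p1: "(norm (L z2))\<^sup>2 = quad_form M w z2"
    and ne: "\<And>t. L (z1 + t *\<^sub>R (z2 - z1)) \<noteq> 0"
    and t0: "0 \<le> t0" "t0 \<le> 1"
  defines "p \<equiv> \<lambda>t. z1 + t *\<^sub>R (z2 - z1)"
  shows "(norm (L (p t0)))\<^sup>2 = quad_form M w (p t0)"
proof (rule ccontr)
  assume not: "(norm (L (p t0)))\<^sup>2 \<noteq> quad_form M w (p t0)"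
  define S where "S = {t. (norm (L (p t)))\<^sup>2 = quad_form M w (p t)}"
  have contL: "continuous_on A L" for A by (rule linear_continuous_on_compose[OF continuous_on_id L, simplified])
  have "closed S"
    unfolding S_def p_def
    by (intro closed_Collect_eq continuous_intros
        continuous_on_compose2[OF contL] continuous_on_compose2[OF continuous_on_quad_form]) auto
  \<comment> \<open>\<open>s\<close> and \<open>t\<close> are the ends of the gap around \<open>t0\<close>; \<open>\<tau>\<close> below is a contact inside it.\<close>
  have "compact (S \<inter> {0..t0})" "compact (S \<inter> {t0..1})"
    using \<open>closed S\<close> by (auto intro: closed_Int_compact)
  moreover have "0 \<in> S \<inter> {0..t0}" "1 \<in> S \<inter> {t0..1}" using p0 p1 t0 by (auto simp: S_def p_def)
  ultimately obtain s t where s: "s \<in> S \<inter> {0..t0}" and s_max: "\<And>r. r \<in> S \<inter> {0..t0} \<Longrightarrow> r \<le> s"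
    and t: "t \<in> S \<inter> {t0..1}" and t_min: "\<And>r. r \<in> S \<inter> {t0..1} \<Longrightarrow> t \<le> r"
    using compact_attains_sup[of "S \<inter> {0..t0}"] compact_attains_inf[of "S \<inter> {t0..1}"] by blast
  have "s \<noteq> t0" "t \<noteq> t0" using s t not by (auto simp: S_def)
  then have st: "s < t0" "t0 < t" using s t by auto
  define \<alpha> \<beta> where "\<alpha> = inverse (norm (L (p s)))" and "\<beta> = inverse (norm (L (p t)))"
  have pos: "0 < \<alpha>" "0 < \<beta>" using ne by (simp_all add: \<alpha>_def \<beta>_def p_def)
  define \<tau> where "\<tau> = (\<alpha> * s + \<beta> * t) / (\<alpha> + \<beta>)"
  have eq: "(\<alpha> + \<beta>) * \<tau> = \<alpha> * s + \<beta> * t" using pos by (simp add: \<tau>_def)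
  have "\<alpha> *\<^sub>R p s + \<beta> *\<^sub>R p t = (\<alpha> + \<beta>) *\<^sub>R z1 + ((\<alpha> + \<beta>) * \<tau>) *\<^sub>R (z2 - z1)"
    unfolding eq p_def by (simp add: algebra_simps)
  also have "\<dots> = (\<alpha> + \<beta>) *\<^sub>R p \<tau>" by (simp add: p_def scaleR_add_right)
  finally have comb: "\<alpha> *\<^sub>R p s + \<beta> *\<^sub>R p t = (\<alpha> + \<beta>) *\<^sub>R p \<tau>" .
  have "(norm (L (\<alpha> *\<^sub>R p s + \<beta> *\<^sub>R p t)))\<^sup>2 = quad_form M w (\<alpha> *\<^sub>R p s + \<beta> *\<^sub>R p t)"
    unfolding \<alpha>_def \<beta>_def using s t ne
    by (intro contact_between[OF L rhombus maj]) (auto simp: S_def p_def)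
  then have "\<tau> \<in> S"
    using contact_scale[OF L, of "(\<alpha> + \<beta>) *\<^sub>R p \<tau>" M w "inverse (\<alpha> + \<beta>)"] pos
    by (simp add: comb S_def)
  moreover have "\<alpha> * (\<tau> - s) = \<beta> * (t - \<tau>)" using eq by (simp add: algebra_simps)
  then have "s < \<tau> \<and> \<tau> < t"
    using pos st by (smt (verit) mult_less_0_iff mult_pos_pos zero_less_mult_iff mult_le_0_iff)
  ultimately show False
    using s_max[of \<tau>] t_min[of \<tau>] s t by (cases "\<tau> \<le> t0") auto
qed

lemma contact_on_cone:
  fixes L :: "complex \<Rightarrow> 'a::real_normed_vector"
  assumes L: "linear L" "inj L"
    and rhombus: "\<forall>u v :: 'a. norm u = 1 \<longrightarrow> norm v = 1 \<longrightarrow> (norm (u + v))\<^sup>2 + (norm (u - v))\<^sup>2 = 4"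
    and maj: "\<And>z. (norm (L z))\<^sup>2 \<le> quad_form M w z"
    and p0: "(norm (L z1))\<^sup>2 = quad_form M w z1"
    and p1: "(norm (L z2))\<^sup>2 = quad_form M w z2"
    and indep: "Im (cnj z1 * z2) \<noteq> 0"
    and st: "0 \<le> s" "0 \<le> t"
  shows "(norm (L (s *\<^sub>R z1 + t *\<^sub>R z2)))\<^sup>2 = quad_form M w (s *\<^sub>R z1 + t *\<^sub>R z2)"
proof (cases "s + t = 0")
  case True
  then have "s = 0" "t = 0" using st by auto
  then show ?thesis by (simp add: linear_0[OF L(1)] quad_form_def)
next
  case False
  have ne: "L (z1 + r *\<^sub>R (z2 - z1)) \<noteq> 0" for r
  proof
    assume "L (z1 + r *\<^sub>R (z2 - z1)) = 0"
    then have 0: "z1 + r *\<^sub>R (z2 - z1) = 0" using L by (simp add: linear_injective_0)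
    have "Im (cnj (z1 + r *\<^sub>R (z2 - z1)) * z2) = (1 - r) * Im (cnj z1 * z2)"
      and "Im (cnj z1 * (z1 + r *\<^sub>R (z2 - z1))) = r * Im (cnj z1 * z2)"
      by (simp_all add: algebra_simps)
    then show False using indep by (simp add: 0)
  qed
  have "s *\<^sub>R z1 + t *\<^sub>R z2 = (s + t) *\<^sub>R z1 + t *\<^sub>R (z2 - z1)"
    by (simp add: algebra_simps)
  also have "\<dots> = (s + t) *\<^sub>R (z1 + (t / (s + t)) *\<^sub>R (z2 - z1))"
    using False by (simp add: scaleR_add_right)
  finally have eq: "s *\<^sub>R z1 + t *\<^sub>R z2 = (s + t) *\<^sub>R (z1 + (t / (s + t)) *\<^sub>R (z2 - z1))" .
  show ?thesis unfolding eq using st False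
    by (intro contact_scale[OF L(1)] contact_on_segment[OF L(1) rhombus maj p0 p1 ne]) auto
qed

text \<open>The points \<open>\<plusminus>z1, \<plusminus>z2\<close> are all contacts, and the four cones that they span cover the plane.\<close>

lemma contact_everywhere:
  fixes L :: "complex \<Rightarrow> 'a::real_normed_vector"
  assumes L: "linear L" "inj L"
    and rhombus: "\<forall>u v :: 'a. norm u = 1 \<longrightarrow> norm v = 1 \<longrightarrow> (norm (u + v))\<^sup>2 + (norm (u - v))\<^sup>2 = 4"
    and maj: "\<And>z. (norm (L z))\<^sup>2 \<le> quad_form M w z"
    and p0: "(norm (L z1))\<^sup>2 = quad_form M w z1"
    and p1: "(norm (L z2))\<^sup>2 = quad_form M w z2"
    and indep: "Im (cnj z1 * z2) \<noteq> 0"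
  shows "(norm (L z))\<^sup>2 = quad_form M w z"
proof -
  \<comment> \<open>\<open>Im (cnj y * z)\<close> is the determinant of \<open>y, z\<close>, so this is Cramer's rule.\<close>
  define d where "d = Im (cnj z1 * z2)"
  define s t where "s = Im (cnj z * z2) / d" and "t = Im (cnj z1 * z) / d"
  have "d *\<^sub>R z = Im (cnj z * z2) *\<^sub>R z1 + Im (cnj z1 * z) *\<^sub>R z2"
    by (simp add: complex_eq_iff d_def algebra_simps)
  also have "\<dots> = d *\<^sub>R (s *\<^sub>R z1 + t *\<^sub>R z2)"
    using indep by (simp add: s_def t_def d_def scaleR_add_right)
  finally have z: "z = s *\<^sub>R z1 + t *\<^sub>R z2"
    using indep by (simp only: scaleR_cancel_left) (simp add: d_def)
  have minus: "(norm (L (- y)))\<^sup>2 = quad_form M w (- y)" if "(norm (L y))\<^sup>2 = quad_form M w y" for y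
    using contact_scale[OF L(1) that, of "-1"] by simp
  note cone = contact_on_cone[OF L rhombus maj]
  consider "0 \<le> s" "0 \<le> t" | "0 \<le> s" "t \<le> 0" | "s \<le> 0" "0 \<le> t" | "s \<le> 0" "t \<le> 0" by linarith
  then show ?thesis
  proof cases
    case 1
    then show ?thesis unfolding z using indep by (intro cone p0 p1)
  next
    case 2
    then show ?thesis
      using cone[OF p0 minus[OF p1], of s "- t"] indep by (simp add: z)
  next
    case 3
    then show ?thesis
      using cone[OF minus[OF p0] p1, of "- s" t] indep by (simp add: z)
  next
    case 4
    then show ?thesis
      using cone[OF minus[OF p0] minus[OF p1], of "- s" "- t"] indep by (simp add: z)
  qed
qed

section \<open>The rhombus law characterises inner product norms\<close>

lemma square_norm_quadratic_on_injective_plane: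
  fixes L :: "complex \<Rightarrow> 'a::real_normed_vector"
  assumes L: "linear L" "inj L"
    and rhombus: "\<forall>u v :: 'a. norm u = 1 \<longrightarrow> norm v = 1 \<longrightarrow> (norm (u + v))\<^sup>2 + (norm (u - v))\<^sup>2 = 4"
  obtains M w where "\<And>z. (norm (L z))\<^sup>2 = quad_form M w z"
proof -
  have contL: "continuous_on A L" for A by (rule linear_continuous_on_compose[OF continuous_on_id L(1), simplified])
  define g where "g z = (norm (L z))\<^sup>2" for z
  have cont: "continuous_on (sphere 0 1) g"
    unfolding g_def by (intro continuous_intros contL)
  have nonneg: "0 \<le> g z" for z by (simp add: g_def)
  obtain M w where maj: "\<And>z. norm z = 1 \<Longrightarrow> g z \<le> quad_form M w z"
    and least: "\<And>M' w'. (\<And>z. norm z = 1 \<Longrightarrow> g z \<le> quad_form M' w' z) \<Longrightarrow> M \<le> M'"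
    using exists_least_quad_form_majorant[OF cont nonneg] by blast
  have contact: "\<exists>z. norm z = 1 \<and> g z = quad_form M w z \<and> z\<^sup>2 \<noteq> z0\<^sup>2" if "norm z0 = 1" for z0
    by (rule least_majorant_has_contact_away_from[of g M w z0]) (use cont maj least that in blast)+
  obtain z1 where z1: "norm z1 = 1" "g z1 = quad_form M w z1"
    using contact[of 1] by auto
  obtain z2 where z2: "norm z2 = 1" "g z2 = quad_form M w z2" "z2\<^sup>2 \<noteq> z1\<^sup>2"
    using contact[OF z1(1)] by blast
  \<comment> \<open>Real-dependent unit vectors agree up to sign and so have equal squares.\<close>
  have indep: "Im (cnj z1 * z2) \<noteq> 0"
  proof
    assume im: "Im (cnj z1 * z2) = 0"
    define r where "r = Re (cnj z1 * z2)"
    have r: "cnj z1 * z2 = of_real r" using im by (simp add: complex_eq_iff r_def)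
    have "norm (cnj z1 * z2) = 1" using z1 z2 by (simp add: norm_mult)
    then have "\<bar>r\<bar> = 1" unfolding r by simp
    then have "r\<^sup>2 = 1" by (auto simp: power2_eq_1_iff abs_if split: if_splits)
    have "z1 * cnj z1 = 1" using z1 by (simp add: complex_norm_square[symmetric])
    then have "z2 = z1 * (cnj z1 * z2)" by (simp flip: mult.assoc)
    then have "z2\<^sup>2 = z1\<^sup>2 * of_real (r\<^sup>2)" by (simp add: r power_mult_distrib)
    then show False using z2(3) \<open>r\<^sup>2 = 1\<close> by simp
  qed
  have maj_all: "(norm (L z))\<^sup>2 \<le> quad_form M w z" for z
  proof (cases "z = 0")
    case True
    then show ?thesis by (simp add: linear_0[OF L(1)] quad_form_def)
  next
    case False
    have z: "z = norm z *\<^sub>R sgn z" using False by (simp add: sgn_div_norm)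
    have "(norm (L z))\<^sup>2 = (norm z)\<^sup>2 * g (sgn z)"
      by (subst z) (simp add: linear_scale[OF L(1)] g_def power_mult_distrib)
    also have "\<dots> \<le> (norm z)\<^sup>2 * quad_form M w (sgn z)"
      using False by (intro mult_left_mono maj) (auto simp: norm_sgn)
    also have "\<dots> = quad_form M w z"
      by (subst (3) z) (simp only: quad_form_scale)
    finally show ?thesis .
  qed
  show thesis
    using contact_everywhere[OF L rhombus maj_all _ _ indep] z1 z2 that by (auto simp: g_def)
qed

lemma square_norm_quadratic_on_plane:
  fixes x y :: "'a::real_normed_vector"
  assumes rhombus: "\<forall>u v :: 'a. norm u = 1 \<longrightarrow> norm v = 1 \<longrightarrow> (norm (u + v))\<^sup>2 + (norm (u - v))\<^sup>2 = 4"
  obtains \<alpha> \<beta> \<gamma> where "\<And>s t. (norm (s *\<^sub>R x + t *\<^sub>R y))\<^sup>2 = \<alpha> * s\<^sup>2 + 2 * \<beta> * s * t + \<gamma> * t\<^sup>2"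
proof -
  define L where "L z = Re z *\<^sub>R x + Im z *\<^sub>R y" for z
  have L: "linear L" by (rule linearI) (simp_all add: L_def algebra_simps)
  show thesis
  proof (cases "inj L")
    case True
    obtain M w where "\<And>z. (norm (L z))\<^sup>2 = quad_form M w z"
      using square_norm_quadratic_on_injective_plane[OF L True rhombus] by blast
    from this[of "Complex s t" for s t] show thesis
      by (intro that[of "M + Re w" "Im w" "M - Re w"]) (simp add: L_def quad_form_Complex)
  next
    case False
    then obtain z where z: "z \<noteq> 0" "L z = 0" using L by (auto simp: linear_injective_0)
    show thesis
    proof (cases "Re z = 0")
      case True
      then have "y = 0" using z by (auto simp: L_def complex_eq_iff)
      then show thesis by (intro that[of "(norm x)\<^sup>2" 0 0]) (simp add: power_mult_distrib)
    next
      case False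
      define c where "c = - Im z / Re z"
      have "Re z *\<^sub>R x = Re z *\<^sub>R (c *\<^sub>R y)"
        using z(2) False by (simp add: L_def c_def eq_neg_iff_add_eq_0)
      then have x: "x = c *\<^sub>R y" using False by (simp only: scaleR_cancel_left) simp
      have "(norm (s *\<^sub>R x + t *\<^sub>R y))\<^sup>2 = (s * c + t)\<^sup>2 * (norm y)\<^sup>2" for s t
        by (simp add: x power_mult_distrib flip: scaleR_add_left)
      then show thesis
        by (intro that[of "c\<^sup>2 * (norm y)\<^sup>2" "c * (norm y)\<^sup>2" "(norm y)\<^sup>2"])
          (simp add: power2_eq_square algebra_simps)
    qed
  qed
qed

text \<open>The parallelogram law and the homogeneity of the polarised form involve two vectors only, so
  both are read off from the quadratic form on the plane of these vectors; additivity, which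
  involves three, follows from them as in the theorem of Jordan and von Neumann.\<close>

lemma induced_by_inner_product_if_rhombus_law:
  assumes rhombus: "\<forall>u v :: 'a::real_normed_vector.
    norm u = 1 \<longrightarrow> norm v = 1 \<longrightarrow> (norm (u + v))\<^sup>2 + (norm (u - v))\<^sup>2 = 4"
  shows "induced_by_inner_product (norm :: 'a \<Rightarrow> real)"
proof -
  define ip :: "'a \<Rightarrow> 'a \<Rightarrow> real" where "ip x y = ((norm (x + y))\<^sup>2 - (norm (x - y))\<^sup>2) / 4" for x y
  have plane: "ip (c *\<^sub>R x) y = c * ip x y"
    "(norm (x + y))\<^sup>2 + (norm (x - y))\<^sup>2 = 2 * (norm x)\<^sup>2 + 2 * (norm y)\<^sup>2" for c x y
  proof -
    obtain \<alpha> \<beta> \<gamma> where Q: "\<And>s t. (norm (s *\<^sub>R x + t *\<^sub>R y))\<^sup>2 = \<alpha> * s\<^sup>2 + 2 * \<beta> * s * t + \<gamma> * t\<^sup>2"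
      using square_norm_quadratic_on_plane[OF rhombus] by blast
    show "ip (c *\<^sub>R x) y = c * ip x y"
      using Q[of c 1] Q[of c "-1"] Q[of 1 1] Q[of 1 "-1"] by (simp add: ip_def)
    show "(norm (x + y))\<^sup>2 + (norm (x - y))\<^sup>2 = 2 * (norm x)\<^sup>2 + 2 * (norm y)\<^sup>2"
      using Q[of 1 1] Q[of 1 "-1"] Q[of 1 0] Q[of 0 1] by simp
  qed
  have sym: "ip x y = ip y x" for x y
    by (simp add: ip_def add.commute norm_minus_commute)
  have scale2: "ip x (c *\<^sub>R y) = c * ip x y" for c x y
    using plane(1)[of c y x] by (simp add: sym)
  have add: "ip (x + y) z = ip x z + ip y z" for x y z
  proof -
    have "(norm (x + y + 2 *\<^sub>R z))\<^sup>2 + (norm (x - y))\<^sup>2 = 2 * (norm (x + z))\<^sup>2 + 2 * (norm (y + z))\<^sup>2"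
      using plane(2)[of "x + z" "y + z"] by (simp add: scaleR_2 algebra_simps)
    moreover have "(norm (x + y - 2 *\<^sub>R z))\<^sup>2 + (norm (x - y))\<^sup>2 = 2 * (norm (x - z))\<^sup>2 + 2 * (norm (y - z))\<^sup>2"
      using plane(2)[of "x - z" "y - z"] by (simp add: scaleR_2 algebra_simps)
    ultimately have "ip (x + y) (2 *\<^sub>R z) = 2 * (ip x z + ip y z)"
      by (simp add: ip_def field_simps)
    then show ?thesis by (simp add: scale2)
  qed
  have add2: "ip z (x + y) = ip z x + ip z y" for x y z
    using add[of x y z] by (simp only: sym[of z])
  have self: "ip x x = (norm x)\<^sup>2" for x
    by (simp add: ip_def power_mult_distrib flip: scaleR_2)
  have "bilinear ip"
    unfolding bilinear_def
    by (intro conjI allI linearI) (simp_all add: add add2 plane(1) scale2)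
  then have "is_inner_product ip" using sym by (simp add: is_inner_product_def self)
  then show ?thesis unfolding induced_by_inner_product_def
    by (intro exI[of _ ip]) (simp add: self)
qed

section \<open>Circumradii in inner product spaces\<close>

context
  fixes ip :: "'a::real_normed_vector \<Rightarrow> 'a \<Rightarrow> real"
  assumes ip: "is_inner_product ip" and norm_ip: "\<And>x. norm x = sqrt (ip x x)"
begin

lemma ip_bilinear: "bilinear ip" and ip_commute: "ip x y = ip y x"
  using ip by (auto simp: is_inner_product_def)

lemmas ip_simps = bilinear_ladd[OF ip_bilinear] bilinear_radd[OF ip_bilinear]
  bilinear_lsub[OF ip_bilinear] bilinear_rsub[OF ip_bilinear]
  bilinear_lmul[OF ip_bilinear] bilinear_rmul[OF ip_bilinear]

lemma ip_self: "ip x x = (norm x)\<^sup>2"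
proof (cases "x = 0")
  case True
  then show ?thesis by (simp add: bilinear_lzero[OF ip_bilinear])
next
  case False
  then have "0 < ip x x" using ip by (simp add: is_inner_product_def)
  then show ?thesis by (simp add: norm_ip)
qed

lemma norm_diff_square: "(norm (x - y))\<^sup>2 = (norm x)\<^sup>2 + (norm y)\<^sup>2 - 2 * ip x y"
  by (simp add: ip_simps ip_commute[of y x] flip: ip_self)

lemma norm_add_square: "(norm (x + y))\<^sup>2 = (norm x)\<^sup>2 + (norm y)\<^sup>2 + 2 * ip x y"
  by (simp add: ip_simps ip_commute[of y x] flip: ip_self)

text \<open>Place the centre of the sphere at the origin, and let \<open>e, f\<close> be the sides of the triangle that
  issue from the vertex \<open>w\<close>. The foot of the perpendicular from the origin to the plane of the triangle is
  its circumcentre, so the circumradius is at most \<open>norm w\<close>. In terms of inner products, the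
  component of \<open>w\<close> orthogonal to \<open>e\<close> and \<open>f\<close> has nonnegative square; the proof computes this square
  after scaling by the Gram determinant \<open>G\<close>.\<close>

lemma sphere_gram_bound:
  fixes e f w :: 'a
  assumes e: "norm (w + e) = norm w" and f: "norm (w + f) = norm w"
    and ne: "e \<noteq> 0" "f \<noteq> 0" "e \<noteq> f"
  shows "(norm e)\<^sup>2 * (norm f)\<^sup>2 * (norm (e - f))\<^sup>2
       \<le> 4 * (norm w)\<^sup>2 * ((norm e)\<^sup>2 * (norm f)\<^sup>2 - (ip e f)\<^sup>2)"
proof -
  define E F k R where "E = (norm e)\<^sup>2" and "F = (norm f)\<^sup>2" and "k = ip e f" and "R = (norm w)\<^sup>2"
  define G where "G = E * F - k\<^sup>2"
  have EF: "0 < E" "0 < F" using ne by (simp_all add: E_def F_def)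
  have we: "ip w e = - E / 2" using norm_add_square[of w e] by (simp add: e E_def)
  have wf: "ip w f = - F / 2" using norm_add_square[of w f] by (simp add: f F_def)
  have ips: "ip e e = E" "ip f f = F" "ip w w = R" "ip e f = k" "ip f e = k"
    "ip w e = - E / 2" "ip e w = - E / 2" "ip w f = - F / 2" "ip f w = - F / 2"
    using we wf by (simp_all add: ip_self E_def F_def R_def k_def ip_commute)
  have nonneg: "0 \<le> ip x x" for x by (simp add: ip_self)
  \<comment> \<open>If \<open>e, f\<close> were dependent, then a line would meet the sphere in three points.\<close>
  have G0: "0 < G"
  proof -
    define h where "h = F *\<^sub>R e - k *\<^sub>R f"
    have h: "ip h h = F * G"
      by (simp add: h_def ip_simps ips G_def power2_eq_square algebra_simps)
    have "ip h h \<noteq> 0"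
    proof
      assume "ip h h = 0"
      then have h0: "h = 0" by (simp add: ip_self)
      have "ip w h = 0" unfolding h0 by (simp add: bilinear_rzero[OF ip_bilinear])
      then have "F * (E - k) = 0" by (auto simp: h_def ip_simps ips algebra_simps)
      then have "E = k" using EF by simp
      moreover have "ip e h = 0" unfolding h0 by (simp add: bilinear_rzero[OF ip_bilinear])
      then have "F * E = k * k" by (simp add: h_def ip_simps ips)
      ultimately have "F = k" using EF by simp
      then have "k *\<^sub>R e = k *\<^sub>R f" using h0 by (simp add: h_def)
      then show False using ne \<open>F = k\<close> EF by simp
    qed
    then have "0 < ip h h" using nonneg[of h] by linarith
    then have "0 < F * G" by (simp only: h)
    then show ?thesis using EF by (simp add: zero_less_mult_iff)
  qed
  define A B where "A = F * (k - E) / 2" and "B = E * (k - F) / 2"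
  \<comment> \<open>Cramer's rule: \<open>A, B\<close> solve the normal equations for the projection of \<open>G w\<close>.\<close>
  have AB: "A * E + B * k = - (G * E / 2)" "A * k + B * F = - (G * F / 2)"
    "A * E + B * F = - (E * F * (E + F - 2 * k) / 2)"
    by (simp_all add: A_def B_def G_def power2_eq_square field_simps)
  have "ip (G *\<^sub>R w - A *\<^sub>R e - B *\<^sub>R f) (G *\<^sub>R w - A *\<^sub>R e - B *\<^sub>R f)
      = G * (R * G) + A * (A * E + B * k) + B * (A * k + B * F) + G * (A * E + B * F)"
    by (simp add: ip_simps ips algebra_simps)
  also have "\<dots> = G * (R * G + (A * E + B * F) / 2)"
    unfolding AB(1,2) by (simp add: field_simps)
  also have "\<dots> = G * (R * G - E * F * (E + F - 2 * k) / 4)"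
    unfolding AB(3) by simp
  finally have "ip (G *\<^sub>R w - A *\<^sub>R e - B *\<^sub>R f) (G *\<^sub>R w - A *\<^sub>R e - B *\<^sub>R f)
      = G * (R * G - E * F * (E + F - 2 * k) / 4)" .
  then have "0 \<le> G * (R * G - E * F * (E + F - 2 * k) / 4)" using nonneg by metis
  then have "0 \<le> R * G - E * F * (E + F - 2 * k) / 4" using G0 by (simp add: zero_le_mult_iff)
  then show ?thesis
    using norm_diff_square[of e f] by (simp add: E_def F_def k_def R_def G_def)
qed

lemma circumradius_on_sphere_le:
  fixes u v w x0 :: 'a
  assumes "u \<in> sphere x0 r" "v \<in> sphere x0 r" "w \<in> sphere x0 r"
    and dist: "u \<noteq> v" "v \<noteq> w" "w \<noteq> u" and r: "0 < r"
  shows "circumradius u v w \<le> ereal r"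
proof -
  define e f where "e = u - w" and "f = v - w"
  have n: "norm ((w - x0) + e) = norm (w - x0)" "norm ((w - x0) + f) = norm (w - x0)"
    and nw: "norm (w - x0) = r"
    using assms(1-3) by (simp_all add: e_def f_def dist_norm norm_minus_commute)
  have d: "dist u v = norm (e - f)" "dist v w = norm f" "dist w u = norm e"
    by (simp_all add: e_def f_def dist_norm norm_minus_commute)
  have "(norm e)\<^sup>2 * (norm f)\<^sup>2 * (norm (e - f))\<^sup>2
       \<le> 4 * r\<^sup>2 * ((norm e)\<^sup>2 * (norm f)\<^sup>2 - (ip e f)\<^sup>2)"
    using sphere_gram_bound[OF n] dist unfolding nw by (auto simp: e_def f_def)
  moreover have "(norm f)\<^sup>2 + (norm e)\<^sup>2 - (norm (e - f))\<^sup>2 = 2 * ip e f"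
    by (simp add: norm_diff_square)
  ultimately show ?thesis
    unfolding circumradius_le_iff[OF dist r] d by (simp add: power_mult_distrib algebra_simps)
qed

lemma sup_circumradius_sphere:
  fixes x0 :: 'a
  assumes dim: "\<exists>B :: 'a set. independent B \<and> card B = 2" and r: "0 < r"
  shows "sup_circumradius (sphere x0 r) = ereal r"
proof (rule antisym)
  show "sup_circumradius (sphere x0 r) \<le> ereal r"
    unfolding sup_circumradius_def
    using circumradius_on_sphere_le r by (intro Sup_least) blast
  obtain x y :: 'a where xy: "independent {x, y}" "x \<noteq> y"
    using dim by (metis card_2_iff)
  define u v where "u = r *\<^sub>R sgn x" and "v = r *\<^sub>R sgn y"
  have x0y0: "x \<noteq> 0" "y \<noteq> 0" using xy dependent_zero by blast+
  have n: "norm u = r" "norm v = r" using x0y0 r by (simp_all add: u_def v_def norm_sgn)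
  have indep: "x \<noteq> c *\<^sub>R y" for c
  proof
    assume "x = c *\<^sub>R y"
    then have "x \<in> span {y}" by (simp add: span_scale span_base)
    then show False using xy by (simp add: independent_insert)
  qed
  have ne: "u \<noteq> c *\<^sub>R v" for c
  proof
    assume "u = c *\<^sub>R v"
    then have "(norm x / r) *\<^sub>R u = (norm x / r * c * r / norm y) *\<^sub>R y"
      by (simp add: v_def sgn_div_norm divide_inverse mult_ac)
    moreover have "(norm x / r) *\<^sub>R u = x" using r x0y0 by (simp add: u_def sgn_div_norm)
    ultimately show False using indep by simp
  qed
  have uv: "u \<noteq> v" "u \<noteq> - v" using ne[of 1] ne[of "-1"] by simp_all
  have u0: "u \<noteq> - u"
  proof
    assume "u = - u"
    then have "2 *\<^sub>R u = 0" by (simp add: scaleR_2 eq_neg_iff_add_eq_0)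
    then show False using n r by simp
  qed
  have ne3: "x0 + u \<noteq> x0 - u" "x0 - u \<noteq> x0 + v" "x0 + v \<noteq> x0 + u"
    using uv u0 by (auto simp: minus_equation_iff[of u])
  have d: "dist (x0 + u) (x0 - u) = 2 * r"
  proof -
    have "(x0 + u) - (x0 - u) = 2 *\<^sub>R u" by (simp add: scaleR_2)
    then show ?thesis by (simp add: dist_norm n)
  qed
  have d2: "dist (x0 - u) (x0 + v) = norm (u + v)" "dist (x0 + v) (x0 + u) = norm (u - v)"
  proof -
    have "(x0 - u) - (x0 + v) = - (u + v)" by simp
    then show "dist (x0 - u) (x0 + v) = norm (u + v)" unfolding dist_norm by (metis norm_minus_cancel)
  qed (simp add: dist_norm norm_minus_commute)
  have "circumradius (x0 + u) (x0 - u) (x0 + v) = ereal r"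
    by (rule circumradius_eq_half_side[OF ne3 d]) (unfold d2, simp add: norm_add_square norm_diff_square n)
  moreover have "circumradius (x0 + u) (x0 - u) (x0 + v) \<le> sup_circumradius (sphere x0 r)"
    using n ne3 by (intro circumradius_le_sup) (simp_all add: dist_norm)
  ultimately show "ereal r \<le> sup_circumradius (sphere x0 r)" by simp
qed

end

section \<open>Inner product spaces characterised by circumradii on spheres\<close>

theorem theorem1p9:
  assumes dim_ge_2: "\<exists>B :: 'a::real_normed_vector set. independent B \<and> card B = 2"
  shows "(induced_by_inner_product (norm :: 'a \<Rightarrow> real) \<longleftrightarrow>
            (\<forall>(x0::'a) r. 0 < r \<longrightarrow> sup_circumradius (sphere x0 r) = ereal r))
       \<and> ((\<forall>(x0::'a) r. 0 < r \<longrightarrow> sup_circumradius (sphere x0 r) = ereal r) \<longleftrightarrow>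
            (\<exists>(x0::'a) r. 0 < r \<and> sup_circumradius (sphere x0 r) = ereal r))"
proof -
  let ?i = "induced_by_inner_product (norm :: 'a \<Rightarrow> real)"
  let ?ii = "\<forall>(x0::'a) r. 0 < r \<longrightarrow> sup_circumradius (sphere x0 r) = ereal r"
  let ?iii = "\<exists>(x0::'a) r. 0 < r \<and> sup_circumradius (sphere x0 r) = ereal r"
  have "?ii" if "?i"
    using that sup_circumradius_sphere dim_ge_2 unfolding induced_by_inner_product_def by blast
  moreover have "?iii" if "?ii" using that zero_less_one by blast
  moreover have "?i" if "?iii"
  proof -
    from that obtain x0 :: 'a and r where "0 < r" "sup_circumradius (sphere x0 r) \<le> ereal r"
      by (metis order_refl)
    then show ?thesis
      by (blast intro: induced_by_inner_product_if_rhombus_law rhombus_law_if_sup_circumradius_le)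
  qed
  ultimately show ?thesis by blast
qed

end
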